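(* There is a universal constant $C>0$ such that the following holds. Let $n\ge 3$, $m=n^3$, $\rho\ge 1$, $\varepsilon=1/(\rho n^2)$, let $s\in[1,n]$ be an integer, and let $\Gamma$ be the $n\times m$ standard Gaussian matrix. Let $\Lambda=\log(n\rho)$, and let $L$ and the event $\mathcal{E}^{(U)}$ be as defined in the context. Assume that $\mathcal{E}^{(U)}$ holds. Let $A\in\mathcal{A}_\varepsilon$ and let $\omega=\Gamma_{S(A)}$ be the induced exposed realization. Let $k\in\{1,\dots,n\}$ and set $$t=t(k)=\Bigl\lceil \frac{k}{\Lambda}\Bigr\rceil,\qquad r_0=\frac{L}{\sqrt t}.$$ Then $$p_k(A;\omega)=\gamma_n\bigl(4\rho\,\mathcal{P}^{(k)}(A;\omega)\bigr)\ \le\ \binom{n}{k}\binom{n}{t}\binom{t+k}{k}\Bigl(\frac{C\rho\,(L+\sqrt k\, r_0)}{k}\Bigr)^k .$$ Moreover, $\sqrt k\,r_0\le L\sqrt{\Lambda}$, hence $L+\sqrt k\,r_0\le C L\sqrt{\log(n\rho)}$, and consequently $$p_k(A;\omega)\ \le\ \binom{n}{t}\binom{t+k}{k}\Bigl(\frac{C\rho L n\sqrt{\log(n\rho)}}{k^2}\Bigr)^k .$$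
   Context: $\Gamma=[g_1\cdots g_m]\in\mathbb{R}^{n\times m}$ has independent $N(0,1)$ entries; $\gamma_n$ is the standard Gaussian measure on $\mathbb{R}^n$. For a vector $x$, $\operatorname{supp}(x)$ is the set of indices of its nonzero coordinates. $\mathcal{A}_\varepsilon$ is the set of matrices $A\in\mathbb{R}^{m\times n}$ with all entries in $\varepsilon\mathbb{Z}$ such that every column $A^{(i)}$ satisfies $\|A^{(i)}\|_1\le 1$ and $|\operatorname{supp}(A^{(i)})|\le n$. For such $A$, $S(A)=\bigcup_{i=1}^n\operatorname{supp}(A^{(i)})\subset[m]$. For $J\subset[m]$, $\Gamma_J$ is the submatrix of the columns of $\Gamma$ indexed by $J$; for a matrix $B$ with $m$ rows, $B_J$ is its restriction to the rows in $J$. $K/U$ decomposition at threshold $1/s$: for $A\in\mathbb{R}^{m\times n}$, let $F_1(A)=A^{(K)}$ be obtained from $A$ by keeping the entries with $|A_{ji}|\ge 1/s$ and replacing the others by $0$, and let $F_2(A)=A^{(U)}=A-A^{(K)}$ (the entries with $|A_{ji}|<1/s$). For $A\in\mathcal{A}_\varepsilon$ and $\omega=\Gamma_{S(A)}$, set, for $i\in[n]$, $v_i=\omega\,F_{1}(A)_{S(A)}e_i\in\mathbb{R}^n$, $u_i=\omega\,F_{2}(A)_{S(A)}e_i\in\mathbb{R}^n$, and $w_i=v_i$, $w_{n+i}=u_i$. For $I\subset[2n]$ with $|I|=n$, $\mathcal{P}_I(A;\omega)=\operatorname{conv}\{\pm w_i:i\in I\}$, and $$\mathcal{P}^{(k)}(A;\omega)=\bigcup_{I\subset[2n],\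 |I|=n,\ |I\cap\{n+1,\dots,2n\}|=k}\mathcal{P}_I(A;\omega).$$ Let $\mathcal{U}_\varepsilon$ be the set of $u\in(\varepsilon\mathbb{Z})^m$ with $|\operatorname{supp}(u)|\le n$ and $\|u\|_2^2\le 1/s$. Set $L=C_0\sqrt{\frac{n}{s}\log(n\rho)}$, where $C_0>0$ is a fixed sufficiently large universal constant, and $\mathcal{E}^{(U)}=\{\max_{u\in\mathcal{U}_\varepsilon}\|\Gamma u\|_2\le L\}$. *)

theory Defs
  imports "HOL-Probability.Probability"
begin

text \<open>
  The dimension \<open>n\<close> is quantified inside the theorem, after the universal constant, so it cannot be
  a type. Vectors of \<open>\<real>\<^sup>D\<close> are the extensional functions on the index set \<open>D\<close> (the elements of
  \<open>D \<rightarrow>\<^sub>E UNIV\<close>), and matrices with rows \<open>R\<close> and columns \<open>D\<close> are the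
  extensional functions on \<open>R \<times> D\<close>. Index sets are \<open>{1..n}\<close>, \<open>{1..m}\<close> and their subsets;
  a submatrix keeps its original row and column labels and is given by \<open>restrict\<close>.
\<close>

type_synonym rvec = "nat \<Rightarrow> real"
type_synonym rmat = "nat \<times> nat \<Rightarrow> real"

definition supp :: "nat set \<Rightarrow> rvec \<Rightarrow> nat set" where
  "supp D x = {j \<in> D. x j \<noteq> 0}"

definition column :: "nat set \<Rightarrow> rmat \<Rightarrow> nat \<Rightarrow> rvec" where
  "column R A i = (\<lambda>j\<in>R. A (j, i))"

definition mat_vec :: "nat set \<Rightarrow> nat set \<Rightarrow> rmat \<Rightarrow> rvec \<Rightarrow> rvec" where
  "mat_vec R D B x = (\<lambda>l\<in>R. \<Sum>j\<in>D. B (l, j) * x j)"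

definition basis_vec :: "nat set \<Rightarrow> nat \<Rightarrow> rvec" where
  "basis_vec D i = (\<lambda>j\<in>D. if j = i then 1 else 0)"

definition scale_vec :: "nat set \<Rightarrow> real \<Rightarrow> rvec \<Rightarrow> rvec" where
  "scale_vec D c x = (\<lambda>l\<in>D. c * x l)"

text \<open>The function type is not an instance of \<open>real_vector\<close>, so \<open>convex hull\<close> does not apply;
  this is the set of all convex combinations of finitely many points of \<open>X\<close>.\<close>

definition conv :: "nat set \<Rightarrow> rvec set \<Rightarrow> rvec set" where
  "conv D X = {(\<lambda>l\<in>D. \<Sum>x\<in>F. c x * x l) | F c.
      finite F \<and> F \<subseteq> X \<and> (\<forall>x\<in>F. 0 \<le> c x) \<and> sum c F = 1}"

definition lattice :: "real \<Rightarrow> real set" where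
  "lattice \<epsilon> = {\<epsilon> * of_int z | z :: int. True}"

definition std_normal :: "real measure" where
  "std_normal = density lborel (\<lambda>x. ennreal (std_normal_density x))"

definition std_gaussian :: "nat \<Rightarrow> rvec measure" where
  "std_gaussian n = PiM {1..n} (\<lambda>_. std_normal)"

text \<open>The law of the random matrix with independent \<open>N(0,1)\<close> entries. The random matrix is taken on
  its canonical probability space: a sample point is the realization of the matrix itself.\<close>

definition gaussian_matrix :: "nat \<Rightarrow> nat \<Rightarrow> rmat measure" where
  "gaussian_matrix n m = PiM ({1..n} \<times> {1..m}) (\<lambda>_. std_normal)"

definition matrices_A :: "nat \<Rightarrow> nat \<Rightarrow> real \<Rightarrow> rmat set" where
  "matrices_A n m \<epsilon> = {A \<in> {1..m} \<times> {1..n} \<rightarrow>\<^sub>E lattice \<epsilon>. \<forall>i\<in>{1..n}.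
      (\<Sum>j\<in>{1..m}. \<bar>column {1..m} A i j\<bar>) \<le> 1 \<and> card (supp {1..m} (column {1..m} A i)) \<le> n}"

definition total_supp :: "nat \<Rightarrow> nat \<Rightarrow> rmat \<Rightarrow> nat set" where
  "total_supp n m A = (\<Union>i\<in>{1..n}. supp {1..m} (column {1..m} A i))"

definition cols :: "nat \<Rightarrow> rmat \<Rightarrow> nat set \<Rightarrow> rmat" where
  "cols n \<Gamma> J = restrict \<Gamma> ({1..n} \<times> J)"

definition rows :: "nat \<Rightarrow> rmat \<Rightarrow> nat set \<Rightarrow> rmat" where
  "rows n B J = restrict B (J \<times> {1..n})"

definition K_part :: "nat \<Rightarrow> nat \<Rightarrow> nat \<Rightarrow> rmat \<Rightarrow> rmat" where
  "K_part n m s A = (\<lambda>p\<in>{1..m} \<times> {1..n}. if \<bar>A p\<bar> \<ge> 1 / real s then A p else 0)"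

definition U_part :: "nat \<Rightarrow> nat \<Rightarrow> nat \<Rightarrow> rmat \<Rightarrow> rmat" where
  "U_part n m s A = (\<lambda>p\<in>{1..m} \<times> {1..n}. A p - K_part n m s A p)"

text \<open>\<open>\<omega> B\<^sub>S e\<^sub>i\<close> with \<open>S = total_supp n m A\<close>.\<close>

definition exposed_image :: "nat \<Rightarrow> nat \<Rightarrow> rmat \<Rightarrow> rmat \<Rightarrow> rmat \<Rightarrow> nat \<Rightarrow> rvec" where
  "exposed_image n m A \<omega> B i =
    (let S = total_supp n m A
     in mat_vec {1..n} S \<omega> (mat_vec S {1..n} (rows n B S) (basis_vec {1..n} i)))"

definition vec_v :: "nat \<Rightarrow> nat \<Rightarrow> nat \<Rightarrow> rmat \<Rightarrow> rmat \<Rightarrow> nat \<Rightarrow> rvec" where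
  "vec_v n m s A \<omega> i = exposed_image n m A \<omega> (K_part n m s A) i"

definition vec_u :: "nat \<Rightarrow> nat \<Rightarrow> nat \<Rightarrow> rmat \<Rightarrow> rmat \<Rightarrow> nat \<Rightarrow> rvec" where
  "vec_u n m s A \<omega> i = exposed_image n m A \<omega> (U_part n m s A) i"

definition vec_w :: "nat \<Rightarrow> nat \<Rightarrow> nat \<Rightarrow> rmat \<Rightarrow> rmat \<Rightarrow> nat \<Rightarrow> rvec" where
  "vec_w n m s A \<omega> i = (if i \<le> n then vec_v n m s A \<omega> i else vec_u n m s A \<omega> (i - n))"

definition polytope_I :: "nat \<Rightarrow> nat \<Rightarrow> nat \<Rightarrow> rmat \<Rightarrow> rmat \<Rightarrow> nat set \<Rightarrow> rvec set" where
  "polytope_I n m s A \<omega> I =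
    conv {1..n} (\<Union>i\<in>I. {vec_w n m s A \<omega> i, scale_vec {1..n} (-1) (vec_w n m s A \<omega> i)})"

definition polytope_k :: "nat \<Rightarrow> nat \<Rightarrow> nat \<Rightarrow> rmat \<Rightarrow> rmat \<Rightarrow> nat \<Rightarrow> rvec set" where
  "polytope_k n m s A \<omega> k =
    (\<Union>I \<in> {I. I \<subseteq> {1..2 * n} \<and> card I = n \<and> card (I \<inter> {n + 1..2 * n}) = k}.
       polytope_I n m s A \<omega> I)"

text \<open>The set whose measure is taken is a finite union of polytopes, hence measurable.\<close>

definition p_k :: "nat \<Rightarrow> nat \<Rightarrow> nat \<Rightarrow> real \<Rightarrow> nat \<Rightarrow> rmat \<Rightarrow> rmat \<Rightarrow> real" where
  "p_k n m s \<rho> k A \<omega> =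
    measure (std_gaussian n) (scale_vec {1..n} (4 * \<rho>) ` polytope_k n m s A \<omega> k)"

definition vectors_U :: "nat \<Rightarrow> nat \<Rightarrow> nat \<Rightarrow> real \<Rightarrow> rvec set" where
  "vectors_U n m s \<epsilon> = {u \<in> {1..m} \<rightarrow>\<^sub>E lattice \<epsilon>.
      card (supp {1..m} u) \<le> n \<and> (L2_set u {1..m})\<^sup>2 \<le> 1 / real s}"

definition L_bound :: "real \<Rightarrow> nat \<Rightarrow> nat \<Rightarrow> real \<Rightarrow> real" where
  "L_bound C0 n s \<rho> = C0 * sqrt (real n / real s * ln (real n * \<rho>))"

lemma zero_in_vectors_U: "(\<lambda>j\<in>{1..m}. 0) \<in> vectors_U n m s \<epsilon>"
proof -
  have "(0::real) \<in> lattice \<epsilon>"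
    unfolding lattice_def by (auto intro: exI[of _ 0])
  moreover have "L2_set (\<lambda>j\<in>{1..m}. 0) {1..m} = 0"
    by (simp add: L2_set_def)
  moreover have "supp {1..m} (\<lambda>j\<in>{1..m}. 0) = {}"
    by (simp add: supp_def)
  ultimately show ?thesis
    by (auto simp: vectors_U_def)
qed

lemma finite_vectors_U:
  assumes "\<epsilon> > 0"
  shows "finite (vectors_U n m s \<epsilon>)"
proof -
  define b where "b = sqrt (1 / real s) / \<epsilon>"
  define Z where "Z = (\<lambda>z::int. \<epsilon> * of_int z) ` {-\<lceil>b\<rceil>..\<lceil>b\<rceil>}"
  have "u j \<in> Z" if u: "u \<in> vectors_U n m s \<epsilon>" and j: "j \<in> {1..m}" for u j
  proof -
    from u j obtain z :: int where z: "u j = \<epsilon> * of_int z"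
      by (auto simp: vectors_U_def lattice_def PiE_def Pi_def)
    have "\<bar>u j\<bar> \<le> L2_set u {1..m}"
      using member_le_L2_set[of "{1..m}" j "\<lambda>i. \<bar>u i\<bar>"] j by (simp add: L2_set_def)
    also have "\<dots> \<le> sqrt (1 / real s)"
      using u by (intro real_le_rsqrt) (simp add: vectors_U_def)
    finally have "\<bar>real_of_int z\<bar> \<le> b"
      using assms by (simp add: z b_def abs_mult field_simps)
    then have "z \<in> {-\<lceil>b\<rceil>..\<lceil>b\<rceil>}"
      by (simp add: abs_le_iff) linarith
    then show ?thesis
      using z by (auto simp: Z_def)
  qed
  then have "vectors_U n m s \<epsilon> \<subseteq> {1..m} \<rightarrow>\<^sub>E Z"
    by (auto simp: vectors_U_def PiE_def Pi_def)
  moreover have "finite ({1..m} \<rightarrow>\<^sub>E Z)"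
    by (intro finite_PiE) (auto simp: Z_def)
  ultimately show ?thesis
    by (rule finite_subset)
qed

definition event_U :: "real \<Rightarrow> nat \<Rightarrow> nat \<Rightarrow> nat \<Rightarrow> real \<Rightarrow> real \<Rightarrow> rmat set" where
  "event_U C0 n m s \<rho> \<epsilon> = {\<Gamma> \<in> space (gaussian_matrix n m).
      Max ((\<lambda>u. L2_set (mat_vec {1..n} {1..m} \<Gamma> u) {1..n}) ` vectors_U n m s \<epsilon>)
        \<le> L_bound C0 n s \<rho>}"

end

theory Submission
  imports Defs
begin

text \<open>
  A polytope \<open>P_I\<close> has \<open>n - k\<close> generators \<open>v_i\<close>, which may be long, and \<open>k\<close> generators
  \<open>u_i\<close>, which have length at most \<open>L\<close> on the event. The two kinds are treated differently.

  The long generators are discarded by projection. There are \<open>n choose k\<close> ways to choose them, and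
  for each choice \<open>V\<close> there are \<open>k\<close> orthonormal vectors \<open>f_1, ..., f_k\<close> orthogonal to every \<open>v_i\<close> with
  \<open>i \<in> V\<close>. Only the coordinates \<open>\<langle>f_j, x\<rangle>\<close> of a point \<open>x\<close> are used, and in these coordinates \<open>x\<close> agrees
  with a convex combination \<open>y\<close> of \<open>0\<close> and the \<open>\<plusminus>u_i\<close>.

  The short generators are handled by Maurey's empirical method (\<open>maurey_sampling\<close>): \<open>y\<close> is within
  \<open>r0 = L / sqrt t\<close> of the average of some \<open>t\<close> points chosen, with repetition, from \<open>0\<close> and the \<open>\<plusminus>u_i\<close>,
  \<open>i = 1, ..., n\<close>. There are at most \<open>(2n + 1)^t\<close> such averages, whichever \<open>u_i\<close> generate the polytope.
  Hence the scaled union is covered by \<open>(n choose k) (2n + 1)^t\<close> tubes of radius \<open>R = 4 \<rho> r0\<close> around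
  translates of subspaces of codimension \<open>k\<close> (\<open>gaussian_measure_hybrid_hulls\<close>).

  Each tube has measure at most \<open>(e R / sqrt k)^k\<close> (\<open>gaussian_measure_tube\<close>). By Markov's
  inequality this follows from a bound on the expectation of \<open>exp (- b Q / 2)\<close>, where \<open>Q\<close> is the
  squared distance in the projection. Writing the Gaussian function of the distance as
  an average of characters \<open>exp (i \<langle>g, \<cdot>\<rangle>)\<close> over a second Gaussian vector \<open>g\<close> and exchanging the
  integrals reduces that bound to the characteristic function of \<open>N(0,1)\<close>
  (\<open>gaussian_laplace_transform_of_projection\<close>).

  It remains to compare \<open>(2n + 1)^t\<close> with \<open>n choose t\<close>. Their quotient is at most \<open>3^t t^t\<close>. If \<open>t \<ge> 2\<close>
  then \<open>t \<Lambda> \<le> 2 k\<close> because \<open>t\<close> is \<open>k / \<Lambda>\<close> rounded up, and \<open>t \<le> n \<le> exp \<Lambda>\<close>, so \<open>t^t \<le> exp (2 k)\<close>: the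
  loss is a constant to the power \<open>k\<close> (\<open>sampling_count_le\<close>). In the other direction, \<open>t \<ge> k / \<Lambda>\<close> keeps
  the radius small: \<open>sqrt k * r0 \<le> L * sqrt \<Lambda>\<close>.
\<close>

section \<open>Inner products and orthonormal families on a finite index set\<close>

definition dot :: "'a set \<Rightarrow> ('a \<Rightarrow> real) \<Rightarrow> ('a \<Rightarrow> real) \<Rightarrow> real" where
  "dot D x y = (\<Sum>l\<in>D. x l * y l)"

text \<open>
  Gaussian elimination, one equation at a time: either the new equation is trivial, or it determines
  one unknown, whose elimination leaves one equation and one unknown fewer.
\<close>

lemma homogeneous_system_nontrivial_solution:
  fixes a :: "'i \<Rightarrow> 'a \<Rightarrow> real"
  assumes "finite I" "finite D" "card I < card D"
  shows "\<exists>x. (\<exists>j\<in>D. x j \<noteq> 0) \<and> (\<forall>i\<in>I. dot D (a i) x = 0)"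
  using assms
proof (induction I arbitrary: D a rule: finite_induct)
  case empty
  then obtain j where "j \<in> D" by fastforce
  then show ?case by (auto intro!: exI[of _ "\<lambda>_. 1"])
next
  case (insert i0 I)
  show ?case
  proof (cases "\<forall>j\<in>D. a i0 j = 0")
    case True
    obtain x where "\<exists>j\<in>D. x j \<noteq> 0" "\<forall>i\<in>I. dot D (a i) x = 0"
      using insert.IH[of D a] insert.prems insert.hyps by auto
    with True show ?thesis by (intro exI[of _ x]) (auto simp: dot_def)
  next
    case False
    then obtain j0 where j0: "j0 \<in> D" "a i0 j0 \<noteq> 0" by auto
    define D' where "D' = D - {j0}"
    define b where "b i j = a i j - a i j0 * a i0 j / a i0 j0" for i j
    have D': "finite D'" "card I < card D'" "D = insert j0 D'" "j0 \<notin> D'"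
      using insert.prems insert.hyps j0 by (auto simp: D'_def)
    obtain x where x: "\<exists>j\<in>D'. x j \<noteq> 0" "\<forall>i\<in>I. dot D' (b i) x = 0"
      using insert.IH[of D' b] D' by auto
    \<comment> \<open>the eliminated unknown takes the value that the equation \<open>i0\<close> forces\<close>
    define y where "y = x(j0 := - dot D' (a i0) x / a i0 j0)"
    have dy: "dot D c y = dot D' c x - c j0 * dot D' (a i0) x / a i0 j0" for c
    proof -
      have "(\<Sum>l\<in>D'. c l * y l) = (\<Sum>l\<in>D'. c l * x l)"
        using D' by (intro sum.cong) (auto simp: y_def)
      then show ?thesis using D' by (simp add: dot_def y_def)
    qed
    have "dot D' (b i) x = dot D' (a i) x - a i j0 * dot D' (a i0) x / a i0 j0" for i
      by (simp add: dot_def b_def sum_subtractf algebra_simps sum_distrib_left sum_divide_distrib)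
    with x dy have "\<forall>i\<in>I. dot D (a i) y = 0" by simp
    moreover have "dot D (a i0) y = 0" using dy[of "a i0"] j0 by simp
    moreover have "\<exists>j\<in>D. y j \<noteq> 0" using x D' by (auto simp: y_def)
    ultimately show ?thesis by (intro exI[of _ y]) auto
  qed
qed

definition orthonormal :: "'a set \<Rightarrow> nat \<Rightarrow> (nat \<Rightarrow> 'a \<Rightarrow> real) \<Rightarrow> bool" where
  "orthonormal D k f \<longleftrightarrow> (\<forall>i<k. \<forall>j<k. dot D (f i) (f j) = (if i = j then 1 else 0))"

lemma dot_commute: "dot D x y = dot D y x"
  by (simp add: dot_def mult.commute)

lemma dot_scale_right: "dot D x (\<lambda>l. c * y l) = c * dot D x y"
  by (simp add: dot_def sum_distrib_left algebra_simps)

lemma dot_scale_left: "dot D (\<lambda>l. c * x l) y = c * dot D x y"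
  by (simp add: dot_def sum_distrib_left algebra_simps)

lemma dot_self_eq_L2_set: "dot D x x = (L2_set x D)\<^sup>2"
  by (simp add: dot_def L2_set_def power2_eq_square sum_nonneg)

text \<open>
  The vectors are found one by one: as long as \<open>W\<close> and the family together have fewer than \<open>card D\<close>
  members, some nonzero vector is orthogonal to all of them.
\<close>

lemma orthonormal_family_orthogonal_to:
  assumes "finite W" "finite D" "card W + k \<le> card D"
  shows "\<exists>f. orthonormal D k f \<and> (\<forall>i<k. \<forall>w\<in>W. dot D w (f i) = 0)"
  using assms(3)
proof (induction k)
  case 0
  show ?case by (simp add: orthonormal_def)
next
  case (Suc k)
  then obtain f where f: "orthonormal D k f" "\<forall>i<k. \<forall>w\<in>W. dot D w (f i) = 0" by auto
  have "card (W \<union> f ` {..<k}) \<le> card W + card (f ` {..<k})" by (rule card_Un_le)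
  also have "\<dots> \<le> card W + k" using card_image_le[of "{..<k}" f] by simp
  finally have "card (W \<union> f ` {..<k}) < card D" using Suc.prems by simp
  then obtain x where x: "\<exists>j\<in>D. x j \<noteq> 0" "\<forall>w\<in>W \<union> f ` {..<k}. dot D w x = 0"
    using homogeneous_system_nontrivial_solution[of "W \<union> f ` {..<k}" D "\<lambda>w. w"] assms by auto
  define N where "N = dot D x x"
  have "N > 0" using x(1) assms(2) unfolding N_def dot_def
    by (auto intro!: sum_pos2 simp: zero_less_mult_iff linorder_neq_iff)
  define y where "y = (\<lambda>l. (1 / sqrt N) * x l)"
  have "dot D y y = (1 / sqrt N) * ((1 / sqrt N) * N)"
    by (simp only: y_def dot_scale_right dot_scale_left N_def)
  with \<open>N > 0\<close> have yy: "dot D y y = 1" by simp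
  have yw: "dot D w y = 0" if "w \<in> W \<union> f ` {..<k}" for w
    using x(2) that unfolding y_def dot_scale_right by simp
  have fy: "dot D (f i) y = 0" if "i < k" for i
    using yw that by blast
  then have yf: "dot D y (f i) = 0" if "i < k" for i
    using that by (subst dot_commute) blast
  define g where "g = f(k := y)"
  have "orthonormal D (Suc k) g"
    using f(1) yy fy yf by (auto simp: orthonormal_def g_def less_Suc_eq)
  moreover have "\<forall>i<Suc k. \<forall>w\<in>W. dot D w (g i) = 0"
    using f(2) yw by (auto simp: g_def less_Suc_eq)
  ultimately show ?case by blast
qed

lemma dot_sum_right: "dot D x (\<lambda>l. \<Sum>i\<in>I. c i * f i l) = (\<Sum>i\<in>I. c i * dot D x (f i))"
  unfolding dot_def sum_distrib_left by (subst sum.swap) (simp add: algebra_simps)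

lemma norm_orthonormal_combination:
  assumes "orthonormal D k f"
  shows "dot D (\<lambda>l. \<Sum>i<k. c i * f i l) (\<lambda>l. \<Sum>i<k. c i * f i l) = (\<Sum>i<k. (c i)\<^sup>2)"
proof -
  have "dot D (\<lambda>l. \<Sum>i<k. c i * f i l) (f j) = c j" if "j < k" for j
  proof -
    have "dot D (\<lambda>l. \<Sum>i<k. c i * f i l) (f j) = (\<Sum>i<k. c i * dot D (f j) (f i))"
      by (subst dot_commute) (rule dot_sum_right)
    also have "\<dots> = (\<Sum>i<k. if i = j then c i else 0)"
      using assms that by (intro sum.cong) (auto simp: orthonormal_def)
    finally show ?thesis using that by simp
  qed
  then show ?thesis by (simp add: dot_sum_right power2_eq_square)
qed

text \<open>
  Expanding the nonnegative squared length of \<open>h\<close> minus its projection onto the span of the family.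
\<close>

lemma bessel_inequality:
  assumes "orthonormal D k f"
  shows "(\<Sum>i<k. (dot D (f i) h)\<^sup>2) \<le> dot D h h"
proof -
  define b where "b i = dot D (f i) h" for i
  define g where "g = (\<lambda>l. \<Sum>i<k. b i * f i l)"
  have "0 \<le> (\<Sum>l\<in>D. (h l - g l)\<^sup>2)" by (simp add: sum_nonneg)
  also have "\<dots> = dot D h h - 2 * dot D h g + dot D g g"
    by (simp add: dot_def power2_eq_square algebra_simps sum.distrib sum_subtractf sum_distrib_left)
  also have "dot D h g = (\<Sum>i<k. (b i)\<^sup>2)"
    by (simp add: g_def dot_sum_right b_def dot_commute[of D h] power2_eq_square)
  also have "dot D g g = (\<Sum>i<k. (b i)\<^sup>2)"
    unfolding g_def by (rule norm_orthonormal_combination[OF assms])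
  finally show ?thesis by (simp add: b_def)
qed

section \<open>Gaussian measure of a tube around an affine subspace\<close>

lemma sets_std_normal [measurable_cong, simp]: "sets std_normal = sets borel"
  and space_std_normal [simp]: "space std_normal = UNIV"
  by (simp_all add: std_normal_def)

interpretation std_normal: prob_space std_normal
  unfolding std_normal_def by (rule prob_space_normal_density) simp

interpretation std_normal_family: product_sigma_finite "\<lambda>_. std_normal"
  by unfold_locales

lemma prob_space_PiM_std_normal: "prob_space (PiM D (\<lambda>_. std_normal))"
  by (rule prob_space_PiM) unfold_locales

lemma integral_iexp_std_normal:
  "(CLINT g|std_normal. iexp (a * g)) = complex_of_real (exp (- (a\<^sup>2) / 2))"
  using fun_cong[OF char_std_normal_distribution, of a]
  by (simp add: char_def std_normal_def)

lemma gaussian_fourier_transform: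
  assumes "finite D"
  shows "(CLINT x|PiM D (\<lambda>_. std_normal). iexp (dot D a x)) = complex_of_real (exp (- dot D a a / 2))"
proof -
  have "(CLINT x|PiM D (\<lambda>_. std_normal). iexp (dot D a x))
      = (CLINT x|PiM D (\<lambda>_. std_normal). (\<Prod>l\<in>D. iexp (a l * x l)))"
    using assms by (simp add: dot_def exp_sum[symmetric] sum_distrib_left)
  also have "\<dots> = (\<Prod>l\<in>D. (CLINT g|std_normal. iexp (a l * g)))"
    by (intro std_normal_family.product_integral_prod assms std_normal.integrable_const_bound[where B=1])
      (auto simp: norm_exp_i_times)
  also have "\<dots> = complex_of_real (\<Prod>l\<in>D. exp (- ((a l)\<^sup>2) / 2))"
    unfolding of_real_prod by (intro prod.cong refl integral_iexp_std_normal)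
  also have "(\<Prod>l\<in>D. exp (- ((a l)\<^sup>2) / 2)) = exp (- dot D a a / 2)"
    using assms by (simp add: exp_sum[symmetric] dot_def power2_eq_square sum_negf sum_divide_distrib)
  finally show ?thesis .
qed

text \<open>
  The integrand times the standard density is a multiple of the density of a normal law with variance
  \<open>1 / (1 + b)\<close>, so the multiple is the integral.
\<close>

lemma integral_exp_square_std_normal:
  assumes "b \<ge> 0"
  shows "(\<integral>g. exp (- (b * g\<^sup>2 / 2)) \<partial>std_normal) = 1 / sqrt (1 + b)"
proof -
  define \<sigma> where "\<sigma> = 1 / sqrt (1 + b)"
  have s2: "\<sigma>\<^sup>2 = 1 / (1 + b)" and s0: "\<sigma> > 0" using assms by (auto simp: \<sigma>_def power_divide)
  have eq: "std_normal_density g * exp (- (b * g\<^sup>2 / 2)) = \<sigma> * normal_density 0 \<sigma> g" for g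
  proof -
    have "sqrt (2 * pi * \<sigma>\<^sup>2) = sqrt (2 * pi) * \<sigma>"
      using s0 by (simp add: real_sqrt_mult)
    moreover have "- (g\<^sup>2) / (2 * \<sigma>\<^sup>2) = - g\<^sup>2 / 2 + - (b * g\<^sup>2 / 2)"
      using assms unfolding s2 by (simp add: field_simps)
    ultimately show ?thesis using s0
      by (simp add: std_normal_density_def normal_density_def exp_add[symmetric])
  qed
  have "(\<integral>g. exp (- (b * g\<^sup>2 / 2)) \<partial>std_normal)
      = (\<integral>g. std_normal_density g * exp (- (b * g\<^sup>2 / 2)) \<partial>lborel)"
    unfolding std_normal_def by (subst integral_density) auto
  also have "\<dots> = \<sigma>"
    using s0 by (simp add: eq)
  finally show ?thesis by (simp add: \<sigma>_def)
qed

text \<open>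
  The coordinates \<open>\<langle>f j, x\<rangle>\<close> behave like independent standard normal variables, and moving the centre \<open>c\<close> away
  from the origin can only lower the integral. To see both at once, introduce a second Gaussian
  vector \<open>g\<close> on \<open>{..<k}\<close>. The integrand is the integral
  over \<open>g\<close> of the unimodular function \<open>h x g\<close>, whose exponent is affine in \<open>x\<close> and linear in \<open>g\<close>. Integrated over \<open>x\<close>
  first, \<open>h\<close> gives a unimodular factor, which carries all of \<open>c\<close> and is dropped by the triangle inequality,
  times \<open>exp (- b |g|^2 / 2)\<close>, because orthonormality turns the length of the combination of the \<open>f j\<close> into
  the length of its coefficient vector.
\<close>

lemma gaussian_laplace_transform_of_projection:
  assumes fin: "finite D" and f: "orthonormal D k f" and b: "b \<ge> 0"
  shows "(\<integral>x. exp (- (b * (\<Sum>j<k. (dot D (f j) x - c j)\<^sup>2) / 2)) \<partial>PiM D (\<lambda>_. std_normal))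
    \<le> (1 / sqrt (1 + b)) ^ k"
proof -
  let ?\<mu> = "PiM D (\<lambda>_. std_normal)" and ?\<nu> = "PiM {..<k} (\<lambda>_. std_normal)"
  interpret mu: prob_space ?\<mu> by (rule prob_space_PiM_std_normal)
  interpret nu: prob_space ?\<nu> by (rule prob_space_PiM_std_normal)
  interpret pair_prob_space ?\<mu> ?\<nu> ..
  define y where "y x j = sqrt b * (dot D (f j) x - c j)" for x j
  define h where "h x g = iexp (dot {..<k} (y x) g)" for x g
  define G where "G g = (\<lambda>l. \<Sum>j<k. (sqrt b * g j) * f j l)" for g
  have int_g: "(CLINT g|?\<nu>. h x g)
      = complex_of_real (exp (- (b * (\<Sum>j<k. (dot D (f j) x - c j)\<^sup>2) / 2)))" for x
  proof -
    have "dot {..<k} (y x) (y x) = b * (\<Sum>j<k. (dot D (f j) x - c j)\<^sup>2)"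
      using b by (simp add: dot_def y_def power_mult_distrib sum_distrib_left
          flip: power2_eq_square)
    then show ?thesis
      unfolding h_def by (subst gaussian_fourier_transform) (auto simp del: of_real_exp)
  qed
  have int_x: "(CLINT x|?\<mu>. h x g)
      = iexp (- (sqrt b * dot {..<k} c g)) * complex_of_real (\<Prod>j<k. exp (- (b * (g j)\<^sup>2 / 2)))" for g
  proof -
    have "h x g = iexp (- (sqrt b * dot {..<k} c g)) * iexp (dot D (G g) x)" for x
    proof -
      have "dot D (G g) x = (\<Sum>j<k. sqrt b * g j * dot D (f j) x)"
        unfolding G_def by (simp add: dot_commute[of D _ x] dot_sum_right)
      then have "dot {..<k} (y x) g = - (sqrt b * dot {..<k} c g) + dot D (G g) x"
        by (simp add: y_def dot_def[of "{..<k}"] sum_subtractf algebra_simps sum_distrib_left)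
      then show ?thesis unfolding h_def
        by (simp only: exp_add[symmetric] of_real_add distrib_left)
    qed
    moreover have "dot D (G g) (G g) = (\<Sum>j<k. b * (g j)\<^sup>2)"
      unfolding G_def norm_orthonormal_combination[OF f] using b by (simp add: power_mult_distrib)
    ultimately show ?thesis
      using fin by (simp add: gaussian_fourier_transform exp_sum[symmetric] sum_negf
          sum_divide_distrib del: of_real_exp)
  qed
  have h_meas: "(\<lambda>p. h (fst p) (snd p)) \<in> borel_measurable (?\<mu> \<Otimes>\<^sub>M ?\<nu>)"
    unfolding h_def y_def dot_def by measurable
  have norm_h: "norm (h x g) = 1" for x g
    by (simp add: h_def norm_exp_i_times)
  have "integrable (?\<mu> \<Otimes>\<^sub>M ?\<nu>) (\<lambda>(x, g). h x g)"
    using h_meas by (intro integrable_const_bound[where B=1]) (simp_all add: norm_h split_beta')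
  then have swap: "(CLINT x|?\<mu>. (CLINT g|?\<nu>. h x g)) = (CLINT g|?\<nu>. (CLINT x|?\<mu>. h x g))"
    by (rule Fubini_integral[symmetric])
  have "complex_of_real (\<integral>x. exp (- (b * (\<Sum>j<k. (dot D (f j) x - c j)\<^sup>2) / 2)) \<partial>?\<mu>)
     = (CLINT g|?\<nu>. iexp (- (sqrt b * dot {..<k} c g)) * complex_of_real (\<Prod>j<k. exp (- (b * (g j)\<^sup>2 / 2))))"
    (is "complex_of_real ?I = ?R") using swap unfolding int_g int_x integral_complex_of_real .
  note I_eq_R = this
  have "?I \<le> norm (complex_of_real ?I)"
    by (simp only: norm_of_real abs_ge_self)
  also have "\<dots> = norm ?R" by (simp only: I_eq_R)
  also have "\<dots> \<le> (\<integral>g. (\<Prod>j<k. exp (- (b * (g j)\<^sup>2 / 2))) \<partial>?\<nu>)"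
  proof (rule order_trans[OF integral_norm_bound])
    have "norm (iexp r * complex_of_real (\<Prod>j<k. exp (z j))) = (\<Prod>j<k. exp (z j))" for r and z :: "nat \<Rightarrow> real"
      by (simp only: norm_mult norm_exp_i_times norm_of_real mult_1) (simp add: prod_nonneg)
    then show "(\<integral>g. norm (iexp (- (sqrt b * dot {..<k} c g))
          * complex_of_real (\<Prod>j<k. exp (- (b * (g j)\<^sup>2 / 2)))) \<partial>?\<nu>)
        \<le> (\<integral>g. (\<Prod>j<k. exp (- (b * (g j)\<^sup>2 / 2))) \<partial>?\<nu>)"
      by (simp only: order_refl)
  qed
  also have "\<dots> = (1 / sqrt (1 + b)) ^ k"
    by (subst std_normal_family.product_integral_prod)
      (use b in \<open>auto simp: integral_exp_square_std_normal intro!: std_normal.integrable_const_bound[where B=1]\<close>)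
  finally show ?thesis .
qed

text \<open>
  Markov's inequality for \<open>exp (- b Q / 2)\<close>, where \<open>Q\<close> is the quadratic form bounded in \<open>T\<close>. The choice
  \<open>b = k / R^2\<close> balances the two factors \<open>exp (b R^2 / 2)\<close> and \<open>(1 + b) powr (- k / 2)\<close>.
\<close>

lemma gaussian_measure_tube:
  fixes c :: "nat \<Rightarrow> real"
  assumes fin: "finite D" and f: "orthonormal D k f" and R: "R > 0" and k: "k > 0"
  defines "T \<equiv> {x \<in> space (PiM D (\<lambda>_. std_normal)). (\<Sum>j<k. (dot D (f j) x - c j)\<^sup>2) \<le> R\<^sup>2}"
  shows "T \<in> sets (PiM D (\<lambda>_. std_normal))"
    and "measure (PiM D (\<lambda>_. std_normal)) T \<le> (exp 1 * R / sqrt (real k)) ^ k"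
proof -
  let ?\<mu> = "PiM D (\<lambda>_. std_normal)"
  interpret mu: prob_space ?\<mu> by (rule prob_space_PiM_std_normal)
  define Q where "Q x = (\<Sum>j<k. (dot D (f j) x - c j)\<^sup>2)" for x
  have [measurable]: "Q \<in> borel_measurable ?\<mu>"
    unfolding Q_def dot_def by measurable
  have T: "T = {x \<in> space ?\<mu>. Q x \<le> R\<^sup>2}" by (simp add: T_def Q_def)
  show "T \<in> sets ?\<mu>" unfolding T by measurable
  define b where "b = real k / R\<^sup>2"
  have b: "b > 0" using R k by (simp add: b_def)
  have Q0: "Q x \<ge> 0" for x by (simp add: Q_def sum_nonneg)
  let ?u = "\<lambda>x. exp (- (b * Q x / 2))"
  have T': "T = {x \<in> space ?\<mu>. ?u x \<ge> exp (- (real k / 2))}"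
    using b R by (auto simp: T b_def field_simps)
  have "measure ?\<mu> T \<le> (\<integral>x. ?u x \<partial>?\<mu>) / exp (- (real k / 2))"
    unfolding T'
    by (rule integral_Markov_inequality_measure[where A="{}"])
      (use b Q0 in \<open>auto intro!: mu.integrable_const_bound[where B=1]\<close>)
  also have "\<dots> \<le> (1 / sqrt (1 + b)) ^ k / exp (- (real k / 2))"
    using gaussian_laplace_transform_of_projection[OF fin f, of b c] b
    by (intro divide_right_mono) (auto simp: Q_def)
  also have "\<dots> \<le> (1 / sqrt b) ^ k / exp (- (real k / 2))"
    using b by (intro divide_right_mono power_mono divide_left_mono) auto
  also have "\<dots> = (R / sqrt (real k)) ^ k * exp (real k / 2)"
    using R by (simp add: b_def real_sqrt_divide exp_minus field_simps)
  also have "\<dots> \<le> (R / sqrt (real k)) ^ k * exp (real k)"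
    using R by (intro mult_left_mono) auto
  also have "\<dots> = (exp 1 * R / sqrt (real k)) ^ k"
    using exp_of_nat_mult[of k "1::real"] by (simp add: power_mult_distrib power_divide)
  finally show "measure ?\<mu> T \<le> (exp 1 * R / sqrt (real k)) ^ k" .
qed

section \<open>Empirical approximation of convex combinations\<close>

text \<open>
  The derandomized form of Maurey's argument. A random point with law \<open>c\<close> has mean \<open>y\<close> and variance at most
  \<open>B\<close>, so adding an independent sample to the sum of deviations increases the expected squared length
  by at most \<open>B\<close>; some outcome \<open>z\<close> does no worse than the expectation. Ordered samples are enough:
  the count that they lead to is compared with a binomial coefficient in \<open>sampling_count_le\<close>.
\<close>

lemma maurey_sampling:
  fixes X :: "('a \<Rightarrow> real) set" and c :: "('a \<Rightarrow> real) \<Rightarrow> real"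
  assumes c: "\<And>z. z \<in> X \<Longrightarrow> 0 \<le> c z" "sum c X = 1"
    and B: "\<And>z. z \<in> X \<Longrightarrow> dot D z z \<le> B"
  defines "y \<equiv> (\<lambda>l. \<Sum>z\<in>X. c z * z l)"
  shows "\<exists>p\<in>{..<t} \<rightarrow> X. dot D (\<lambda>l. \<Sum>i<t. p i l - y l) (\<lambda>l. \<Sum>i<t. p i l - y l) \<le> real t * B"
proof (induction t)
  case 0
  show ?case by (simp add: dot_def)
next
  case (Suc t)
  then obtain p where p: "p \<in> {..<t} \<rightarrow> X"
    and le: "dot D (\<lambda>l. \<Sum>i<t. p i l - y l) (\<lambda>l. \<Sum>i<t. p i l - y l) \<le> real t * B" by auto
  define S where "S = (\<lambda>l. \<Sum>i<t. p i l - y l)"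
  define q where "q z = dot D (\<lambda>l. S l + (z l - y l)) (\<lambda>l. S l + (z l - y l))" for z
  have q: "q z = dot D S S - 2 * dot D S y + dot D y y + 2 * dot D S z + dot D z z - 2 * dot D y z" for z
    by (simp add: q_def dot_def algebra_simps sum.distrib sum_subtractf sum_distrib_left)
  have avg: "(\<Sum>z\<in>X. c z * dot D w z) = dot D w y" for w
    by (simp add: y_def dot_sum_right[where f="\<lambda>z. z"])
  \<comment> \<open>the average of \<open>q\<close> with weights \<open>c\<close> is at most \<open>(t + 1) * B\<close>: the cross term \<open>dot D S (z - y)\<close> averages to zero\<close>
  have "\<exists>z\<in>X. q z \<le> real (Suc t) * B"
  proof (rule ccontr)
    assume "\<not> ?thesis"
    then have gt: "q z > real (Suc t) * B" if "z \<in> X" for z using that by auto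
    have "real (Suc t) * B = (\<Sum>z\<in>X. c z * (real (Suc t) * B))"
      using c(2) by (simp add: sum_distrib_right[symmetric])
    also have "\<dots> < (\<Sum>z\<in>X. c z * q z)"
    proof (rule sum_strict_mono_ex1)
      show "finite X" using c(2) sum.infinite by fastforce
      show "\<forall>z\<in>X. c z * (real (Suc t) * B) \<le> c z * q z"
        by (intro ballI mult_left_mono less_imp_le[OF gt] c(1))
      obtain z where "z \<in> X" "c z \<noteq> 0" using c(2) by (metis sum.neutral zero_neq_one)
      then have "c z * (real (Suc t) * B) < c z * q z"
        using c(1)[of z] gt[of z] by (intro mult_strict_left_mono) auto
      then show "\<exists>z\<in>X. c z * (real (Suc t) * B) < c z * q z"
        using \<open>z \<in> X\<close> by (rule bexI)
    qed
    also have "\<dots> = (\<Sum>z\<in>X. c z * (dot D S S - 2 * dot D S y + dot D y y))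
        + 2 * (\<Sum>z\<in>X. c z * dot D S z) + (\<Sum>z\<in>X. c z * dot D z z) - 2 * (\<Sum>z\<in>X. c z * dot D y z)"
      by (simp add: q algebra_simps sum.distrib sum_subtractf sum_distrib_left)
    also have "\<dots> = dot D S S - dot D y y + (\<Sum>z\<in>X. c z * dot D z z)"
      unfolding avg sum_distrib_right[symmetric] c(2) by simp
    also have "(\<Sum>z\<in>X. c z * dot D z z) \<le> (\<Sum>z\<in>X. c z * B)"
      using c B by (intro sum_mono mult_left_mono) auto
    also have "\<dots> = B" using c(2) by (simp add: sum_distrib_right[symmetric])
    finally have "real (Suc t) * B < dot D S S - dot D y y + B" by simp
    moreover have "dot D y y \<ge> 0" by (simp add: dot_def sum_nonneg)
    ultimately show False using le by (simp add: S_def algebra_simps)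
  qed
  then obtain z where z: "z \<in> X" "q z \<le> real (Suc t) * B" by auto
  have "(\<lambda>l. \<Sum>i<Suc t. (p(t := z)) i l - y l) = (\<lambda>l. S l + (z l - y l))"
    by (auto simp: S_def)
  with z p show ?case
    by (intro bexI[of _ "p(t := z)"]) (auto simp: q_def less_Suc_eq)
qed

text \<open>
  The points of \<open>F\<close> outside \<open>X\<close> are invisible to \<open>f\<close>. Their weight is moved to the zero vector, which makes
  the rest a convex combination of points of \<open>X\<close>, to which Maurey's lemma applies; by Bessel's
  inequality its error does not grow under the projection.
\<close>

lemma projected_hull_near_averages:
  fixes f :: "nat \<Rightarrow> 'a \<Rightarrow> real" and X F :: "('a \<Rightarrow> real) set"
  assumes f: "orthonormal D k f"
    and X: "finite X" "(\<lambda>_. 0) \<in> X" "\<And>z. z \<in> X \<Longrightarrow> dot D z z \<le> B"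
    and F: "finite F" "\<And>z. z \<in> F \<Longrightarrow> 0 \<le> c z" "sum c F = 1"
    and orth: "\<And>z j. z \<in> F - X \<Longrightarrow> j < k \<Longrightarrow> dot D (f j) z = 0"
    and t: "t > 0"
  shows "\<exists>p\<in>{..<t} \<rightarrow>\<^sub>E X. (\<Sum>j<k. (dot D (f j) (\<lambda>l. \<Sum>z\<in>F. c z * z l)
    - dot D (f j) (\<lambda>l. \<Sum>i<t. (1 / real t) * p i l))\<^sup>2) \<le> B / real t"
proof -
  define z0 where "z0 = (\<lambda>_::'a. 0::real)"
  \<comment> \<open>the missing weight goes to \<open>z0\<close>, which may itself belong to \<open>F\<close>\<close>
  define e where "e z = (if z \<in> F then c z else 0) + (if z = z0 then 1 - sum c (F \<inter> X) else 0)" for z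
  have "sum c (F \<inter> X) \<le> sum c F" using F by (intro sum_mono2) auto
  then have e0: "0 \<le> e z" for z using F by (auto simp: e_def)
  have eX: "(\<Sum>z\<in>X. e z * g z) = (\<Sum>z\<in>F \<inter> X. c z * g z) + (1 - sum c (F \<inter> X)) * g z0" for g
  proof -
    have "(\<Sum>z\<in>X. e z * g z) = (\<Sum>z\<in>X. if z \<in> F then c z * g z else 0)
        + (\<Sum>z\<in>X. if z = z0 then (1 - sum c (F \<inter> X)) * g z else 0)"
      unfolding sum.distrib[symmetric] by (intro sum.cong) (auto simp: e_def algebra_simps)
    also have "(\<Sum>z\<in>X. if z \<in> F then c z * g z else 0) = (\<Sum>z\<in>F \<inter> X. c z * g z)"
      using X(1) by (simp add: sum.inter_restrict[symmetric] Int_commute)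
    finally show ?thesis using X by (simp add: z0_def)
  qed
  have e1: "sum e X = 1" using eX[of "\<lambda>_. 1"] by simp
  define y where "y = (\<lambda>l. \<Sum>z\<in>X. e z * z l)"
  have same: "dot D (f j) (\<lambda>l. \<Sum>z\<in>F. c z * z l) = dot D (f j) y" if "j < k" for j
  proof -
    have "dot D (f j) (\<lambda>l. \<Sum>z\<in>F. c z * z l) = (\<Sum>z\<in>F. c z * dot D (f j) z)"
      by (rule dot_sum_right)
    also have "\<dots> = (\<Sum>z\<in>F \<inter> X. c z * dot D (f j) z)"
      using F(1) orth that by (intro sum.mono_neutral_right) auto
    also have "\<dots> = (\<Sum>z\<in>X. e z * dot D (f j) z)"
      unfolding eX by (simp add: z0_def dot_def)
    also have "\<dots> = dot D (f j) y" unfolding y_def by (rule dot_sum_right[symmetric])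
    finally show ?thesis .
  qed
  obtain p where p: "p \<in> {..<t} \<rightarrow> X"
    and le: "dot D (\<lambda>l. \<Sum>i<t. p i l - y l) (\<lambda>l. \<Sum>i<t. p i l - y l) \<le> real t * B"
    using maurey_sampling[of X e D B t] e0 e1 X(3) unfolding y_def by blast
  define p' where "p' = restrict p {..<t}"
  define S where "S = (\<lambda>l. \<Sum>i<t. p i l - y l)"
  have diff: "dot D (f j) y - dot D (f j) (\<lambda>l. \<Sum>i<t. (1 / real t) * p' i l)
      = (- 1 / real t) * dot D (f j) S" for j
  proof -
    have "(\<lambda>l. \<Sum>i<t. (1 / real t) * p' i l) = (\<lambda>l. y l + (1 / real t) * S l)"
      using t by (simp add: S_def p'_def sum_subtractf sum_distrib_left sum_divide_distrib field_simps)
    then show ?thesis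
      by (simp add: dot_def algebra_simps sum.distrib sum_distrib_left sum_negf sum_divide_distrib)
  qed
  have "(\<Sum>j<k. (dot D (f j) (\<lambda>l. \<Sum>z\<in>F. c z * z l)
    - dot D (f j) (\<lambda>l. \<Sum>i<t. (1 / real t) * p' i l))\<^sup>2) = (\<Sum>j<k. ((- 1 / real t) * dot D (f j) S)\<^sup>2)"
    by (intro sum.cong refl) (simp only: lessThan_iff same diff)
  also have "\<dots> = (1 / real t)\<^sup>2 * (\<Sum>j<k. (dot D (f j) S)\<^sup>2)"
    by (simp add: sum_distrib_left power_mult_distrib power_divide)
  also have "\<dots> \<le> (1 / real t)\<^sup>2 * (real t * B)"
    using bessel_inequality[OF f, of S] le by (intro mult_left_mono) (auto simp: S_def)
  also have "\<dots> = B / real t" using t by (simp add: power2_eq_square)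
  finally show ?thesis using p by (intro bexI[of _ p']) (auto simp: p'_def)
qed

section \<open>Gaussian measure of a union of hulls with few short generators\<close>

text \<open>
  The index set \<open>I\<close> enters the cover only through \<open>V = I \<inter> {1..n}\<close>: the net \<open>N\<close> uses all short vectors, not only
  those with index in \<open>I\<close>. So the choice of the \<open>k\<close> short generators costs nothing beyond the net, and a
  single factor \<open>n choose k\<close> remains.
\<close>

lemma gaussian_measure_hybrid_hulls:
  fixes w :: "nat \<Rightarrow> rvec"
  assumes k: "k \<in> {1..n}" and t: "t > 0" and a: "a > 0" and L: "L > 0"
    and short: "\<And>i. i \<in> {n + 1..2 * n} \<Longrightarrow> L2_set (w i) {1..n} \<le> L"
  defines "\<I> \<equiv> {I. I \<subseteq> {1..2 * n} \<and> card I = n \<and> card (I \<inter> {n + 1..2 * n}) = k}"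
  defines "P \<equiv> (\<Union>I\<in>\<I>. conv {1..n} (\<Union>i\<in>I. {w i, scale_vec {1..n} (-1) (w i)}))"
  shows "measure (std_gaussian n) (scale_vec {1..n} a ` P)
    \<le> real (n choose k) * (2 * real n + 1) ^ t * (exp 1 * (a * (L / sqrt (real t))) / sqrt (real k)) ^ k"
proof -
  define D where "D = {1..n}"
  define neg where "neg x = scale_vec D (-1) x" for x
  define X where "X = insert (\<lambda>_. 0) (w ` {n + 1..2 * n} \<union> neg ` w ` {n + 1..2 * n})"
  define \<V> where "\<V> = {V. V \<subseteq> D \<and> card V = n - k}"
  define N where "N = ({..<t} \<rightarrow>\<^sub>E X)"
  define R where "R = a * (L / sqrt (real t))"
  have neg_dot: "dot D y (neg x) = - dot D y x" "dot D (neg x) y = - dot D x y" for x y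
    by (simp_all add: dot_def neg_def scale_vec_def sum_negf)
  have finX: "finite X" by (simp add: X_def)
  have "card X \<le> Suc (card (w ` {n + 1..2 * n} \<union> neg ` w ` {n + 1..2 * n}))"
    unfolding X_def by (rule card_insert_le_m1) auto
  also have "\<dots> \<le> Suc (card (w ` {n + 1..2 * n}) + card (neg ` w ` {n + 1..2 * n}))"
    using card_Un_le by blast
  also have "\<dots> \<le> Suc (n + n)"
    using card_image_le[of "{n + 1..2 * n}" w] card_image_le[of "w ` {n + 1..2 * n}" neg] by simp
  finally have cardX: "card X \<le> 2 * n + 1" by simp
  have cardN: "real (card N) \<le> (2 * real n + 1) ^ t"
  proof -
    have "card N \<le> (2 * n + 1) ^ t"
      using cardX by (simp add: N_def card_PiE power_mono)
    then have "real (card N) \<le> real ((2 * n + 1) ^ t)" by (simp only: of_nat_le_iff)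
    then show ?thesis by (simp add: add.commute)
  qed
  have X_short: "dot D z z \<le> L\<^sup>2" if "z \<in> X" for z
  proof -
    have "dot D (w i) (w i) \<le> L\<^sup>2" if "i \<in> {n + 1..2 * n}" for i
      unfolding dot_self_eq_L2_set using short[OF that]
      by (intro power_mono) (simp_all add: D_def)
    then show ?thesis using that by (auto simp: X_def neg_dot dot_def[of _ "\<lambda>_. 0"])
  qed
  have "\<exists>f. orthonormal D k f \<and> (\<forall>i<k. \<forall>x\<in>w ` V. dot D x (f i) = 0)" if "V \<in> \<V>" for V
  proof -
    have "finite V" "card V = n - k" using that by (auto simp: \<V>_def D_def intro: finite_subset)
    with card_image_le[of V w] k show ?thesis
      by (intro orthonormal_family_orthogonal_to) (auto simp: D_def)
  qed
  then obtain f where f: "\<And>V. V \<in> \<V> \<Longrightarrow> orthonormal D k (f V)"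
    and f_orth: "\<And>V i x. V \<in> \<V> \<Longrightarrow> i < k \<Longrightarrow> x \<in> w ` V \<Longrightarrow> dot D x (f V i) = 0"
    by metis
  \<comment> \<open>the points whose projection is within \<open>R\<close> of that of \<open>a\<close> times the average of \<open>p\<close>\<close>
  define T where "T V p = {x \<in> space (std_gaussian n). (\<Sum>j<k. (dot D (f V j) x
    - a * dot D (f V j) (\<lambda>l. \<Sum>i<t. (1 / real t) * p i l))\<^sup>2) \<le> R\<^sup>2}" for V and p :: "nat \<Rightarrow> rvec"
  have R: "R > 0" using a L t by (simp add: R_def)
  have T_sets: "T V p \<in> sets (std_gaussian n)"
    and T_measure: "measure (std_gaussian n) (T V p) \<le> (exp 1 * R / sqrt (real k)) ^ k"
    if "V \<in> \<V>" for V p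
    using gaussian_measure_tube[OF _ f[OF that] R] k unfolding T_def std_gaussian_def D_def by auto
  have fin\<V>: "finite \<V>" and card\<V>: "card \<V> = n choose k"
    using n_subsets[of D "n - k"] k binomial_symmetric[of k n]
    by (auto simp: \<V>_def D_def)
  have finN: "finite N" unfolding N_def using finX by (intro finite_PiE) auto
  have cover: "scale_vec {1..n} a ` P \<subseteq> (\<Union>V\<in>\<V>. \<Union>p\<in>N. T V p)"
  proof safe
    fix x assume "x \<in> P"
    then obtain I where I: "I \<in> \<I>"
      and "x \<in> conv D (\<Union>i\<in>I. {w i, neg (w i)})" by (auto simp: P_def D_def neg_def)
    then obtain F c where F: "finite F" "F \<subseteq> (\<Union>i\<in>I. {w i, neg (w i)})"
      "\<forall>z\<in>F. 0 \<le> c z" "sum c F = 1" and x: "x = (\<lambda>l\<in>D. \<Sum>z\<in>F. c z * z l)"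
      by (auto simp: conv_def)
    define V where "V = I \<inter> D"
    have I': "I \<subseteq> {1..2 * n}" "card I = n" "card (I \<inter> {n + 1..2 * n}) = k"
      using I by (auto simp: \<I>_def)
    have "card I = card V + card (I \<inter> {n + 1..2 * n})"
      using I'(1) finite_subset[OF I'(1)]
      by (subst card_Un_disjoint[symmetric]) (auto simp: V_def D_def intro!: arg_cong[where f=card])
    then have V: "V \<in> \<V>" using I' by (auto simp: \<V>_def V_def)
    have orth: "dot D (f V j) z = 0" if z: "z \<in> F - X" and j: "j < k" for z j
    proof -
      obtain i where i: "i \<in> I" "z = w i \<or> z = neg (w i)" using z F(2) by blast
      have "i \<in> V"
      proof (rule ccontr)
        assume "i \<notin> V"
        then have "i \<in> {n + 1..2 * n}" using i(1) I'(1) by (auto simp: V_def D_def)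
        with i(2) have "z \<in> X" by (auto simp: X_def)
        with z show False by simp
      qed
      then show ?thesis
        using f_orth[OF V j, of "w i"] i(2) by (auto simp: neg_dot dot_commute[of D "f V j"])
    qed
    have zero: "(\<lambda>_. 0) \<in> X" by (simp add: X_def)
    from F(3) have c0: "0 \<le> c z" if "z \<in> F" for z using that by blast
    obtain p where p: "p \<in> N" and le: "(\<Sum>j<k. (dot D (f V j) (\<lambda>l. \<Sum>z\<in>F. c z * z l)
        - dot D (f V j) (\<lambda>l. \<Sum>i<t. (1 / real t) * p i l))\<^sup>2) \<le> L\<^sup>2 / real t"
      unfolding N_def
      using projected_hull_near_averages[OF f[OF V] finX zero X_short F(1) c0 F(4) orth t] by blast
    have scaled: "dot D (f V j) (scale_vec {1..n} a x) = a * dot D (f V j) (\<lambda>l. \<Sum>z\<in>F. c z * z l)" for j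
      unfolding dot_scale_right[symmetric]
      by (auto simp: dot_def scale_vec_def D_def x intro!: sum.cong)
    have "(\<Sum>j<k. (dot D (f V j) (scale_vec {1..n} a x)
        - a * dot D (f V j) (\<lambda>l. \<Sum>i<t. (1 / real t) * p i l))\<^sup>2)
      = a\<^sup>2 * (\<Sum>j<k. (dot D (f V j) (\<lambda>l. \<Sum>z\<in>F. c z * z l)
        - dot D (f V j) (\<lambda>l. \<Sum>i<t. (1 / real t) * p i l))\<^sup>2)"
      unfolding scaled right_diff_distrib[symmetric] power_mult_distrib sum_distrib_left ..
    also have "\<dots> \<le> a\<^sup>2 * (L\<^sup>2 / real t)" using le by (intro mult_left_mono) auto
    also have "\<dots> = R\<^sup>2" using t by (simp add: R_def power_mult_distrib power_divide)
    finally have "scale_vec {1..n} a x \<in> T V p"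
      by (simp add: T_def std_gaussian_def space_PiM scale_vec_def)
    with V p show "scale_vec {1..n} a x \<in> (\<Union>V\<in>\<V>. \<Union>p\<in>N. T V p)" by blast
  qed
  interpret prob_space "std_gaussian n"
    unfolding std_gaussian_def by (rule prob_space_PiM_std_normal)
  have "measure (std_gaussian n) (scale_vec {1..n} a ` P) \<le> measure (std_gaussian n) (\<Union>V\<in>\<V>. \<Union>p\<in>N. T V p)"
    using cover T_sets fin\<V> finN by (intro finite_measure_mono) (auto intro!: sets.finite_UN)
  also have "\<dots> \<le> (\<Sum>V\<in>\<V>. \<Sum>p\<in>N. measure (std_gaussian n) (T V p))"
    using T_sets fin\<V> finN
    by (intro order_trans[OF finite_measure_subadditive_finite] sum_mono
        finite_measure_subadditive_finite) (auto intro!: sets.finite_UN)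
  also have "\<dots> \<le> (\<Sum>V\<in>\<V>. \<Sum>p\<in>N. (exp 1 * R / sqrt (real k)) ^ k)"
    by (intro sum_mono T_measure)
  also have "\<dots> = real (n choose k) * real (card N) * (exp 1 * R / sqrt (real k)) ^ k"
    by (simp add: card\<V>)
  also have "\<dots> \<le> real (n choose k) * (2 * real n + 1) ^ t * (exp 1 * R / sqrt (real k)) ^ k"
    using cardN R by (intro mult_right_mono mult_left_mono) auto
  finally show ?thesis by (simp add: R_def)
qed

section \<open>Numerical estimates\<close>

text \<open>
  Since \<open>(n / t)^t \<le> n choose t\<close>, the price of counting ordered samples is \<open>t^t\<close>, up to \<open>3^t\<close>. It is affordable since
  \<open>ln t \<le> ln n \<le> \<Lambda>\<close> while \<open>t\<close> is about \<open>k / \<Lambda>\<close>.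
\<close>

lemma sampling_count_le:
  assumes t: "t = nat \<lceil>real k / \<Lambda>\<rceil>" and \<Lambda>: "\<Lambda> \<ge> 1" "ln (real n) \<le> \<Lambda>" and k: "k \<in> {1..n}"
  shows "(2 * real n + 1) ^ t \<le> real (n choose t) * (3 * exp 2) ^ k"
proof -
  have pos: "real k / \<Lambda> > 0" using \<Lambda> k by simp
  then have t_bounds: "real t \<ge> real k / \<Lambda>" "real t < real k / \<Lambda> + 1"
    unfolding t by linarith+
  have t1: "t \<ge> 1" using t_bounds(1) pos by (cases t) auto
  have "real k / \<Lambda> \<le> real k" using \<Lambda> by (simp add: divide_le_eq mult_le_cancel_left1)
  then have tk: "t \<le> k" using t_bounds(2) by linarith
  have tt: "real t ^ t \<le> exp 2 ^ k"
  \<comment> \<open>rounding up at most doubles \<open>k / \<Lambda>\<close>, unless it rounds up to \<open>1\<close>, where \<open>t ^ t\<close> is trivial\<close>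
  proof (cases "t = 1")
    case True
    then show ?thesis by simp
  next
    case False
    with t1 have "real t \<ge> 2" by simp
    with t_bounds(2) have "real k / \<Lambda> > 1" by linarith
    then have "real t \<le> 2 * (real k / \<Lambda>)" using t_bounds(2) by linarith
    then have *: "real t * \<Lambda> \<le> 2 * real k" using \<Lambda> by (simp add: field_simps)
    have "real t \<le> real n" using tk k by simp
    also have "\<dots> = exp (ln (real n))" using k by simp
    also have "\<dots> \<le> exp \<Lambda>" using \<Lambda>(2) by simp
    finally have "real t \<le> exp \<Lambda>" .
    then have "real t ^ t \<le> exp \<Lambda> ^ t" by (intro power_mono) auto
    also have "\<dots> = exp (real t * \<Lambda>)" by (simp add: exp_of_nat_mult)
    also have "\<dots> \<le> exp (real k * 2)" using * by simp
    also have "\<dots> = exp 2 ^ k" by (rule exp_of_nat_mult)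
    finally show ?thesis .
  qed
  have "(2 * real n + 1) ^ t \<le> (3 * real n) ^ t" using k by (intro power_mono) auto
  also have "\<dots> = 3 ^ t * (real n / real t) ^ t * real t ^ t"
    using t1 by (simp add: power_mult_distrib power_divide)
  also have "\<dots> \<le> 3 ^ k * real (n choose t) * exp 2 ^ k"
    using tk k tt binomial_ge_n_over_k_pow_k[of t n, where ?'a=real]
    by (intro mult_mono) (auto intro: power_increasing)
  finally show ?thesis by (simp add: power_mult_distrib algebra_simps)
qed

text \<open>
  From \<open>(n choose k) * k! \<le> n^k\<close> and \<open>k^k / k! \<le> exp k\<close>, a single term of the exponential series.
\<close>

lemma binomial_le_exp_pow:
  assumes "k \<ge> 1"
  shows "real (n choose k) \<le> (exp 1 * real n / real k) ^ k"
proof -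
  have "real k ^ k / fact k \<le> exp (real k)"
  proof -
    have "summable (\<lambda>i. real k ^ i / fact i)" 
      using summable_exp[of "real k"] by (simp add: divide_inverse mult.commute)
    then have "(\<Sum>i\<in>{k}. real k ^ i / fact i) \<le> (\<Sum>i. real k ^ i / fact i)"
      by (intro sum_le_suminf) auto
    also have "\<dots> = exp (real k)" by (simp add: exp_def divide_inverse mult.commute)
    finally show ?thesis by simp
  qed
  moreover have "real (n choose k) * fact k \<le> real n ^ k"
    using binomial_fact_pow[of n k] by (metis of_nat_fact of_nat_le_iff of_nat_mult of_nat_power)
  ultimately have "real (n choose k) * fact k * (real k ^ k / fact k) \<le> real n ^ k * exp (real k)"
    by (intro mult_mono) auto
  then have "real (n choose k) * real k ^ k \<le> (exp 1 * real n) ^ k"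
    using exp_of_nat_mult[of k "1::real"] by (simp add: power_mult_distrib mult.commute)
  then show ?thesis using assms by (simp add: power_divide field_simps)
qed

lemma one_le_ln_of_ge_3:
  assumes "x \<ge> (3::real)"
  shows "ln x \<ge> 1"
  using exp_le assms by (subst ln_ge_iff) linarith+

section \<open>Length of the generators with small coefficients\<close>

text \<open>
  The vector \<open>u_i\<close> is \<open>\<Gamma> a\<close> for the column \<open>a\<close> of the small entries of \<open>A\<close>, and \<open>a\<close> is one of the vectors over which
  the event takes its maximum: its entries are below \<open>1 / s\<close> and their absolute values sum to at most \<open>1\<close>, so their
  squares sum to at most \<open>1 / s\<close>.
\<close>

lemma L2_set_vec_u_le:
  assumes \<Gamma>: "\<Gamma> \<in> event_U C0 n m s \<rho> \<epsilon>" and A: "A \<in> matrices_A n m \<epsilon>"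
    and s: "s \<ge> 1" and \<epsilon>: "\<epsilon> > 0" and i: "i \<in> {1..n}"
  shows "L2_set (vec_u n m s A (cols n \<Gamma> (total_supp n m A)) i) {1..n} \<le> L_bound C0 n s \<rho>"
proof -
  define S where "S = total_supp n m A"
  define a where "a = column {1..m} (U_part n m s A) i"
  have a: "a j = (if \<bar>A (j, i)\<bar> \<ge> 1 / real s then 0 else A (j, i))" if "j \<in> {1..m}" for j
    using that i by (simp add: a_def column_def U_part_def K_part_def)
  have S_sub: "S \<subseteq> {1..m}" by (auto simp: S_def total_supp_def supp_def)
  have off: "A (j, i) = 0" if "j \<in> {1..m} - S" for j
    using that i by (auto simp: S_def total_supp_def supp_def column_def)
  have "vec_u n m s A (cols n \<Gamma> S) i = mat_vec {1..n} {1..m} \<Gamma> a"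
  proof
    fix l
    have row: "mat_vec S {1..n} (rows n (U_part n m s A) S) (basis_vec {1..n} i) j = a j" if "j \<in> S" for j
    proof -
      have "(\<Sum>i'\<in>{1..n}. rows n (U_part n m s A) S (j, i') * basis_vec {1..n} i i')
          = (\<Sum>i'\<in>{1..n}. if i' = i then U_part n m s A (j, i) else 0)"
        using that by (intro sum.cong) (auto simp: rows_def basis_vec_def)
      then show ?thesis using that i S_sub by (auto simp: mat_vec_def a_def column_def)
    qed
    have "(\<Sum>j\<in>S. cols n \<Gamma> S (l, j) * mat_vec S {1..n} (rows n (U_part n m s A) S) (basis_vec {1..n} i) j)
        = (\<Sum>j\<in>S. \<Gamma> (l, j) * a j)" if "l \<in> {1..n}"
      by (intro sum.cong refl, subst row) (use that in \<open>auto simp: cols_def\<close>)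
    also have "(\<Sum>j\<in>S. \<Gamma> (l, j) * a j) = (\<Sum>j\<in>{1..m}. \<Gamma> (l, j) * a j)"
      using S_sub off by (intro sum.mono_neutral_left) (auto simp: a)
    finally have sums: "(\<Sum>j\<in>S. cols n \<Gamma> S (l, j)
          * mat_vec S {1..n} (rows n (U_part n m s A) S) (basis_vec {1..n} i) j)
        = (\<Sum>j\<in>{1..m}. \<Gamma> (l, j) * a j)" if "l \<in> {1..n}"
      using that by blast
    show "vec_u n m s A (cols n \<Gamma> S) i l = mat_vec {1..n} {1..m} \<Gamma> a l"
      unfolding vec_u_def exposed_image_def Let_def S_def[symmetric] mat_vec_def[of "{1..n}"]
      by (cases "l \<in> {1..n}") (simp_all only: restrict_apply sums if_True if_False)
  qed
  moreover have "a \<in> vectors_U n m s \<epsilon>"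
  proof -
    have A_lat: "A (j, i) \<in> lattice \<epsilon>" if "j \<in> {1..m}" for j
      using A that i by (auto simp: matrices_A_def PiE_def Pi_def)
    have "(0::real) \<in> lattice \<epsilon>" by (auto simp: lattice_def intro: exI[of _ 0])
    with A_lat have "a \<in> {1..m} \<rightarrow>\<^sub>E lattice \<epsilon>"
      by (auto simp: PiE_iff a) (simp add: a_def column_def extensional_def)
    moreover have "card (supp {1..m} a) \<le> n"
    proof -
      have "supp {1..m} a \<subseteq> supp {1..m} (column {1..m} A i)"
        by (auto simp: supp_def a column_def split: if_splits)
      then have "card (supp {1..m} a) \<le> card (supp {1..m} (column {1..m} A i))"
        by (intro card_mono) (auto simp: supp_def)
      also have "\<dots> \<le> n" using A i by (auto simp: matrices_A_def)
      finally show ?thesis .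
    qed
    moreover have "(L2_set a {1..m})\<^sup>2 \<le> 1 / real s"
    proof -
      have "(L2_set a {1..m})\<^sup>2 = (\<Sum>j\<in>{1..m}. (a j)\<^sup>2)"
        by (simp add: L2_set_def sum_nonneg)
      also have "\<dots> \<le> (\<Sum>j\<in>{1..m}. 1 / real s * \<bar>A (j, i)\<bar>)"
      proof (intro sum_mono)
        fix j assume j: "j \<in> {1..m}"
        have "(a j)\<^sup>2 = \<bar>a j\<bar> * \<bar>a j\<bar>" by (simp add: power2_eq_square)
        also have "\<dots> \<le> 1 / real s * \<bar>A (j, i)\<bar>"
          using a[OF j] by (intro mult_mono) auto
        finally show "(a j)\<^sup>2 \<le> 1 / real s * \<bar>A (j, i)\<bar>" .
      qed
      also have "\<dots> = 1 / real s * (\<Sum>j\<in>{1..m}. \<bar>column {1..m} A i j\<bar>)"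
        by (simp add: sum_distrib_left column_def)
      also have "\<dots> \<le> 1 / real s * 1"
        using A i by (intro mult_left_mono) (auto simp: matrices_A_def)
      finally show ?thesis by simp
    qed
    ultimately show ?thesis by (simp add: vectors_U_def)
  qed
  ultimately have "L2_set (vec_u n m s A (cols n \<Gamma> S) i) {1..n}
      \<le> Max ((\<lambda>u. L2_set (mat_vec {1..n} {1..m} \<Gamma> u) {1..n}) ` vectors_U n m s \<epsilon>)"
    using finite_vectors_U[OF \<epsilon>] by (intro Max_ge) auto
  also have "\<dots> \<le> L_bound C0 n s \<rho>" using \<Gamma> by (simp add: event_U_def)
  finally show ?thesis by (simp add: S_def)
qed

section \<open>The measure bound\<close>

theorem proposition4p5:
  fixes C0 :: real
  assumes "C0 > 0"
  shows "\<exists>C>0. \<forall>(n::nat) (m::nat) (s::nat) (\<rho>::real) (\<epsilon>::real) (\<Lambda>::real) (L::real) \<Gamma> A \<omega> (k::nat) (t::nat) (r0::real).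
    n \<ge> 3 \<longrightarrow> m = n ^ 3 \<longrightarrow> \<rho> \<ge> 1 \<longrightarrow> \<epsilon> = 1 / (\<rho> * real n ^ 2) \<longrightarrow> s \<in> {1..n} \<longrightarrow>
    \<Lambda> = ln (real n * \<rho>) \<longrightarrow> L = L_bound C0 n s \<rho> \<longrightarrow>
    \<Gamma> \<in> event_U C0 n m s \<rho> \<epsilon> \<longrightarrow>
    A \<in> matrices_A n m \<epsilon> \<longrightarrow> \<omega> = cols n \<Gamma> (total_supp n m A) \<longrightarrow>
    k \<in> {1..n} \<longrightarrow> t = nat \<lceil>real k / \<Lambda>\<rceil> \<longrightarrow> r0 = L / sqrt (real t) \<longrightarrow>
      p_k n m s \<rho> k A \<omega>
        \<le> real (n choose k) * real (n choose t) * real ((t + k) choose k)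
            * (C * \<rho> * (L + sqrt (real k) * r0) / real k) ^ k \<and>
      sqrt (real k) * r0 \<le> L * sqrt \<Lambda> \<and>
      L + sqrt (real k) * r0 \<le> C * L * sqrt (ln (real n * \<rho>)) \<and>
      p_k n m s \<rho> k A \<omega>
        \<le> real (n choose t) * real ((t + k) choose k)
            * (C * \<rho> * L * real n * sqrt (ln (real n * \<rho>)) / real k ^ 2) ^ k"
proof -
  \<comment> \<open>\<open>12 * exp 3 = 4 * exp 1 * (3 * exp 2)\<close> comes from the scale \<open>4 * \<rho>\<close>, the tube bound and the sample count; a further \<open>2 * exp 1\<close>
    comes from \<open>L + sqrt k * r0 \<le> 2 * L * sqrt \<Lambda>\<close> and from \<open>n choose k \<le> (exp 1 * n / k) ^ k\<close>\<close>
  define C :: real where "C = 24 * exp 4"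
  have C2: "C \<ge> 2" unfolding C_def using exp_ge_add_one_self[of "4::real"] by simp
  show ?thesis
  proof (rule exI[of _ C], rule conjI, goal_cases)
    case 1
    show ?case using C2 by simp
  next
    case 2
    show ?case
    proof (intro allI impI, goal_cases)
      case (1 n m s \<rho> \<epsilon> \<Lambda> L \<Gamma> A \<omega> k t r0)
      note n = 1(1) and \<rho> = 1(3) and s = 1(5) and \<Lambda>_def = 1(6) and L_def = 1(7)
        and event = 1(8) and A = 1(9) and \<omega> = 1(10) and k = 1(11) and t_def = 1(12) and r0_def = 1(13)
      have "real n * 1 \<le> real n * \<rho>" using \<rho> by (intro mult_left_mono) auto
      then have n\<rho>: "real n \<le> real n * \<rho>" "3 \<le> real n * \<rho>" using n by linarith+
      have \<Lambda>: "\<Lambda> \<ge> 1" "ln (real n) \<le> \<Lambda>"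
        using n\<rho> n one_le_ln_of_ge_3[of "real n * \<rho>"] unfolding \<Lambda>_def by auto
      have L: "L > 0"
        using assms s n \<Lambda> by (simp add: L_def L_bound_def \<Lambda>_def[symmetric])
      have \<epsilon>: "\<epsilon> > 0" using 1(4) n \<rho> by simp
      have t_ge: "real k / \<Lambda> \<le> real t" unfolding t_def by linarith
      have "real k / \<Lambda> > 0" using k \<Lambda> by simp
      with t_ge have t: "t > 0" by (cases t) auto
      have r0: "r0 > 0" using L t by (simp add: r0_def)
      have kr0: "sqrt (real k) * r0 \<le> L * sqrt \<Lambda>"
      proof -
        have "real k \<le> \<Lambda> * real t" using t_ge \<Lambda> by (simp add: divide_le_eq mult.commute)
        then have "sqrt (real k) \<le> sqrt \<Lambda> * sqrt (real t)"
          by (simp flip: real_sqrt_mult)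
        then have "L * sqrt (real k) \<le> L * (sqrt \<Lambda> * sqrt (real t))"
          using L by (intro mult_left_mono) auto
        then show ?thesis using t by (simp add: r0_def divide_le_eq mult_ac)
      qed
      have "L * 1 \<le> L * sqrt \<Lambda>" using L \<Lambda> by (intro mult_left_mono) auto
      with kr0 have sum2: "L + sqrt (real k) * r0 \<le> 2 * (L * sqrt \<Lambda>)" by linarith
      also have "\<dots> \<le> C * (L * sqrt \<Lambda>)" using C2 L \<Lambda> by (intro mult_right_mono) auto
      finally have b3: "L + sqrt (real k) * r0 \<le> C * L * sqrt (ln (real n * \<rho>))"
        by (simp add: \<Lambda>_def mult.assoc)
      define B where "B = real (n choose t) * real ((t + k) choose k)"
      have B0: "B \<ge> 0" by (simp add: B_def)
      define Q where "Q = 12 * exp 3 * \<rho> * (L + sqrt (real k) * r0) / real k"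
      have Q0: "Q \<ge> 0" using \<rho> L r0 by (simp add: Q_def)
      have base: "p_k n m s \<rho> k A \<omega> \<le> real (n choose k) * B * Q ^ k"
      proof -
        have short: "L2_set (vec_w n m s A \<omega> i) {1..n} \<le> L" if "i \<in> {n + 1..2 * n}" for i
        proof -
          have "i - n \<in> {1..n}" using that by auto
          from L2_set_vec_u_le[OF event A _ \<epsilon> this] show ?thesis
            using s that by (simp add: vec_w_def \<omega> L_def)
        qed
        have "p_k n m s \<rho> k A \<omega>
          \<le> real (n choose k) * (2 * real n + 1) ^ t * (exp 1 * (4 * \<rho> * r0) / sqrt (real k)) ^ k"
          unfolding p_k_def polytope_k_def polytope_I_def r0_def
          using \<rho> by (intro gaussian_measure_hybrid_hulls k t L short) auto
        also have "\<dots> \<le> real (n choose k) * (real (n choose t) * (3 * exp 2) ^ k)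
            * (exp 1 * (4 * \<rho> * r0) / sqrt (real k)) ^ k"
          using \<rho> r0 by (intro mult_right_mono mult_left_mono sampling_count_le[OF t_def \<Lambda> k]) auto
        also have "\<dots> = real (n choose k) * real (n choose t) * 1
            * ((3 * exp 2) * (exp 1 * (4 * \<rho> * r0) / sqrt (real k))) ^ k"
          unfolding power_mult_distrib[of "3 * exp 2"] by simp
        also have "\<dots> \<le> real (n choose k) * real (n choose t) * real ((t + k) choose k) * Q ^ k"
        proof (intro mult_mono power_mono order_refl)
          have "exp 2 * exp 1 = (exp 3 :: real)" by (simp flip: exp_add)
          then have "(3 * exp 2) * (exp 1 * (4 * \<rho> * r0) / sqrt (real k))
              = 12 * exp 3 * \<rho> * (r0 / sqrt (real k))" by (simp add: field_simps)
          also have "r0 / sqrt (real k) = sqrt (real k) * r0 / real k"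
            using k by (simp add: field_simps flip: power2_eq_square)
          also have "12 * exp 3 * \<rho> * (sqrt (real k) * r0 / real k) \<le> Q"
            unfolding Q_def times_divide_eq_right using \<rho> L
            by (intro divide_right_mono mult_left_mono) auto
          finally show "(3 * exp 2) * (exp 1 * (4 * \<rho> * r0) / sqrt (real k)) \<le> Q" .
          have "(t + k) choose k > 0" by simp
          then show "1 \<le> real ((t + k) choose k)" by linarith
        qed (use \<rho> r0 Q0 in auto)
        finally show ?thesis by (simp add: B_def mult.assoc)
      qed
      have "12 * exp 3 \<le> C" unfolding C_def by (intro mult_mono) auto
      then have "Q \<le> C * \<rho> * (L + sqrt (real k) * r0) / real k"
        unfolding Q_def using \<rho> L r0 by (intro divide_right_mono mult_right_mono) auto
      then have "real (n choose k) * B * Q ^ k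
          \<le> real (n choose k) * B * (C * \<rho> * (L + sqrt (real k) * r0) / real k) ^ k"
        using Q0 B0 by (intro mult_left_mono power_mono) auto
      with base have b1: "p_k n m s \<rho> k A \<omega>
          \<le> real (n choose k) * real (n choose t) * real ((t + k) choose k)
            * (C * \<rho> * (L + sqrt (real k) * r0) / real k) ^ k"
        by (simp add: B_def mult.assoc)
      have "real (n choose k) * B * Q ^ k \<le> (exp 1 * real n / real k) ^ k * B * Q ^ k"
        using binomial_le_exp_pow[of k n] k B0 Q0 by (intro mult_right_mono) auto
      also have "\<dots> = B * ((exp 1 * real n / real k) * Q) ^ k"
        unfolding power_mult_distrib by simp
      also have "\<dots> \<le> B * (C * \<rho> * L * real n * sqrt \<Lambda> / real k ^ 2) ^ k"
      proof (intro mult_left_mono power_mono)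
        have "Q \<le> 12 * exp 3 * \<rho> * (2 * (L * sqrt \<Lambda>)) / real k"
          unfolding Q_def using \<rho> sum2 by (intro divide_right_mono mult_left_mono) auto
        then have "(exp 1 * real n / real k) * Q
            \<le> (exp 1 * real n / real k) * (12 * exp 3 * \<rho> * (2 * (L * sqrt \<Lambda>)) / real k)"
          by (intro mult_left_mono) auto
        also have "exp 1 * exp 3 = (exp 4 :: real)" by (simp flip: exp_add)
        then have "(exp 1 * real n / real k) * (12 * exp 3 * \<rho> * (2 * (L * sqrt \<Lambda>)) / real k)
            = C * \<rho> * L * real n * sqrt \<Lambda> / real k ^ 2"
          by (simp add: C_def power2_eq_square field_simps)
        finally show "(exp 1 * real n / real k) * Q \<le> C * \<rho> * L * real n * sqrt \<Lambda> / real k ^ 2" .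
      qed (use B0 Q0 in auto)
      finally have b4: "p_k n m s \<rho> k A \<omega> \<le> real (n choose t) * real ((t + k) choose k)
            * (C * \<rho> * L * real n * sqrt (ln (real n * \<rho>)) / real k ^ 2) ^ k"
        using base by (simp add: B_def \<Lambda>_def)
      show ?case using b1 kr0 b3 b4 by blast
    qed
  qed
qed

end
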